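(* Let $0<p\le1$ and let $\mathcal{X}\in\mathbb{C}^{I_1\times\cdots\times I_N}$ be a tensor with an orthonormal Tucker decomposition $\mathcal{X}=[\![\mathcal{G};\mathbf{X}^{(1)},\ldots,\mathbf{X}^{(N)}]\!]$, where $\mathcal{G}\in\mathbb{C}^{J_1\times\cdots\times J_N}$ and $\mathbf{X}^{(n)}\in\mathbb{C}^{I_n\times J_n}$. Then $\|\mathcal{X}\|_p=\|\mathcal{G}\|_p$.
   Context: Mode-$n$ product: for $\mathcal{X}\in\mathbb{C}^{I_1\times\cdots\times I_N}$ and a matrix $\mathbf{A}\in\mathbb{C}^{J\times I_n}$, $[\mathcal{X}\times_n\mathbf{A}]_{i_1\cdots i_{n-1}ji_{n+1}\cdots i_N}=\sum_{i_n=1}^{I_n}x_{i_1\cdots i_N}a_{ji_n}$. Tucker decomposition: $\mathcal{X}=[\![\mathcal{G};\mathbf{X}^{(1)},\ldots,\mathbf{X}^{(N)}]\!]$ means $\mathcal{X}=\mathcal{G}\times_1\mathbf{X}^{(1)}\times_2\cdots\times_N\mathbf{X}^{(N)}$; it is orthonormal if every factor matrix $\mathbf{X}^{(n)}$ has orthonormal columns. Tensor $p$-quasi norm ($0<p\le1$) of $\mathcal{X}\in\mathbb{C}^{I_1\times\cdots\times I_N}$: $$\|\mathcal{X}\|_p=\inf\Big\{\Big(\sum_{s=1}^r|\lambda_s|^p\Big)^{1/p}:\ \mathcal{X}=\sum_{s=1}^r\lambda_s\,\mathbf{x}^{(1)}_s\circ\mathbf{x}^{(2)}_s\circ\cdots\circ\mathbf{x}^{(N)}_s,\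 \|\mathbf{x}^{(n)}_s\|=1\ \forall s,n\Big\},$$ the infimum being over all $r$, scalars $\lambda_s$ and Euclidean unit vectors $\mathbf{x}^{(n)}_s\in\mathbb{C}^{I_n}$; $\circ$ is the outer product of vectors. *)

theory Defs
  imports
    "Jordan_Normal_Form.Matrix"
    "HOL-Analysis.L2_Norm"
    "HOL-Library.FuncSet"
begin

text \<open>
  A tensor carries its list of dimensions; the length of that list is the order \<open>N\<close>. Its entries
  are indexed by lists of natural numbers. Modes and indices count from 0, as for the matrix and
  vector types used here.
\<close>

definition tensor_indices :: "nat list \<Rightarrow> nat list set" where
  "tensor_indices ds = {is. length is = length ds \<and> (\<forall>n<length ds. is ! n < ds ! n)}"

typedef 'a tensor = "{(ds, f :: nat list \<Rightarrow> 'a). f \<in> extensional (tensor_indices ds)}"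
  by auto

setup_lifting type_definition_tensor

lift_definition dims :: "'a tensor \<Rightarrow> nat list" is fst .

lift_definition entry :: "'a tensor \<Rightarrow> nat list \<Rightarrow> 'a" is snd .

lift_definition tensor :: "nat list \<Rightarrow> (nat list \<Rightarrow> 'a) \<Rightarrow> 'a tensor" is
  "\<lambda>ds f. (ds, restrict f (tensor_indices ds))"
  by auto

definition carrier_tensor :: "nat list \<Rightarrow> 'a tensor set" where
  "carrier_tensor ds = {X. dims X = ds}"

lemma dims_tensor [simp]: "dims (tensor ds f) = ds"
  by transfer simp

lemma entry_tensor [simp]: "is \<in> tensor_indices ds \<Longrightarrow> entry (tensor ds f) is = f is"
  by transfer simp

lemma tensor_eqI:
  assumes "dims X = dims Y"
    and "\<And>is. is \<in> tensor_indices (dims X) \<Longrightarrow> entry X is = entry Y is"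
  shows "X = Y"
  using assms by transfer (auto intro: extensionalityI)

text \<open>Meaningful if \<open>n < length (dims X)\<close> and \<open>dim_col A = dims X ! n\<close>.\<close>

definition mode_product :: "complex tensor \<Rightarrow> nat \<Rightarrow> complex mat \<Rightarrow> complex tensor" where
  "mode_product X n A =
     tensor ((dims X)[n := dim_row A])
       (\<lambda>is. \<Sum>k<dims X ! n. entry X (is[n := k]) * A $$ (is ! n, k))"

definition tucker :: "complex tensor \<Rightarrow> complex mat list \<Rightarrow> complex tensor" where
  "tucker G As = fold (\<lambda>n X. mode_product X n (As ! n)) [0..<length As] G"

definition orthonormal_columns :: "complex mat \<Rightarrow> bool" where
  "orthonormal_columns A \<longleftrightarrow>
     (\<forall>i<dim_col A. \<forall>j<dim_col A. col A i \<bullet>c col A j = (if i = j then 1 else 0))"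

definition euclidean_norm :: "complex vec \<Rightarrow> real" where
  "euclidean_norm v = L2_set (\<lambda>i. cmod (v $ i)) {..<dim_vec v}"

definition outer_product :: "complex vec list \<Rightarrow> complex tensor" where
  "outer_product vs = tensor (map dim_vec vs) (\<lambda>is. \<Prod>n<length vs. vs ! n $ (is ! n))"

text \<open>\<open>x s ! n\<close> is the mode-\<open>n\<close> vector of the \<open>s\<close>-th rank-one term.\<close>

definition unit_rank_one_decomposition ::
    "complex tensor \<Rightarrow> nat \<Rightarrow> (nat \<Rightarrow> complex) \<Rightarrow> (nat \<Rightarrow> complex vec list) \<Rightarrow> bool" where
  "unit_rank_one_decomposition X r c x \<longleftrightarrow>
     (\<forall>s<r. length (x s) = length (dims X) \<and>
        (\<forall>n<length (dims X). x s ! n \<in> carrier_vec (dims X ! n) \<and> euclidean_norm (x s ! n) = 1)) \<and>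
     X = tensor (dims X) (\<lambda>is. \<Sum>s<r. c s * entry (outer_product (x s)) is)"

text \<open>
  The set below is bounded below by 0, and it is nonempty because the expansion of \<open>X\<close> in outer
  products of standard basis vectors is an admissible decomposition, so \<open>Inf\<close> on \<open>real\<close> is the
  infimum. The empty decomposition \<open>r = 0\<close> is admitted; it represents the zero tensor.
\<close>

definition tensor_pnorm :: "real \<Rightarrow> complex tensor \<Rightarrow> real" where
  "tensor_pnorm p X =
     Inf {(\<Sum>s<r. cmod (c s) powr p) powr (1 / p) | r c x. unit_rank_one_decomposition X r c x}"

end

theory Submission
  imports Defs "Jordan_Normal_Form.Schur_Decomposition"
begin

text \<open>
  A mode product with a matrix that does not increase the Euclidean norm turns a rank-one
  decomposition into one with smaller weights: the factor by which a mode vector shrinks is absorbed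
  into the scalar. A matrix with orthonormal columns and its adjoint both have this property, and
  the product with the adjoint undoes the product with the matrix, so multiplying one mode by a
  matrix with orthonormal columns preserves the quasi-norm. The Tucker product is an iteration of
  such steps.
\<close>

section \<open>Euclidean norms and matrices with orthonormal columns\<close>

lemma euclidean_norm_nonneg [simp]: "0 \<le> euclidean_norm v"
  by (simp add: euclidean_norm_def L2_set_nonneg)

text \<open>Lets norm statements be proved in the inner product, where a matrix can be moved to the
  other argument as its adjoint.\<close>

lemma cscalar_prod_self: "v \<bullet>c v = complex_of_real ((euclidean_norm v)\<^sup>2)"
proof -
  have "v \<bullet>c v = (\<Sum>i<dim_vec v. complex_of_real ((cmod (v $ i))\<^sup>2))"
    by (auto simp: scalar_prod_def lessThan_atLeast0 simp flip: complex_norm_square intro!: sum.cong)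
  then show ?thesis
    by (simp add: euclidean_norm_def L2_set_def sum_nonneg)
qed

lemma euclidean_norm_eqI:
  assumes "v \<bullet>c v = w \<bullet>c w"
  shows "euclidean_norm v = euclidean_norm w"
proof -
  have "(euclidean_norm v)\<^sup>2 = (euclidean_norm w)\<^sup>2"
    using assms unfolding cscalar_prod_self of_real_eq_iff .
  then show ?thesis
    by (simp add: power2_eq_iff_nonneg)
qed

lemma euclidean_norm_eq_0_iff: "euclidean_norm v = 0 \<longleftrightarrow> v = 0\<^sub>v (dim_vec v)"
  by (auto simp: euclidean_norm_def L2_set_eq_0_iff vec_eq_iff)

lemma euclidean_norm_smult: "euclidean_norm (c \<cdot>\<^sub>v v) = cmod c * euclidean_norm v"
proof -
  have "euclidean_norm (c \<cdot>\<^sub>v v) = L2_set (\<lambda>i. cmod c * cmod (v $ i)) {..<dim_vec v}"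
    unfolding euclidean_norm_def by (rule L2_set_cong) (auto simp: norm_mult)
  then show ?thesis
    by (simp add: euclidean_norm_def L2_set_right_distrib)
qed

lemma euclidean_norm_unit_vec:
  assumes "i < n"
  shows "euclidean_norm (unit_vec n i) = 1"
proof -
  have "(\<Sum>j<n. (cmod (unit_vec n i $ j))\<^sup>2) = (\<Sum>j<n. if j = i then 1 else 0)"
    by (rule sum.cong) (use assms in auto)
  then show ?thesis
    using assms by (simp add: euclidean_norm_def L2_set_def)
qed

text \<open>Polar form of a vector, used to renormalise a mode vector after a matrix has been
  applied. The zero vector must be covered too, since rank-one terms always carry unit vectors;
  positive dimension guarantees that a unit vector exists.\<close>

lemma ex_unit_direction:
  assumes "0 < dim_vec w"
  shows "\<exists>u \<in> carrier_vec (dim_vec w).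
           euclidean_norm u = 1 \<and> w = complex_of_real (euclidean_norm w) \<cdot>\<^sub>v u"
proof (cases "euclidean_norm w = 0")
  \<comment> \<open>The scalar is 0, so any unit vector serves as direction; a standard basis vector
    is taken.\<close>
  case True
  then have "w = complex_of_real (euclidean_norm w) \<cdot>\<^sub>v unit_vec (dim_vec w) 0"
    by (auto simp: euclidean_norm_eq_0_iff vec_eq_iff)
  then show ?thesis
    using assms euclidean_norm_unit_vec[of 0 "dim_vec w"] by auto
next
  case False
  let ?u = "complex_of_real (1 / euclidean_norm w) \<cdot>\<^sub>v w"
  have "euclidean_norm ?u = 1"
    using False by (simp add: euclidean_norm_smult norm_divide)
  moreover have "w = complex_of_real (euclidean_norm w) \<cdot>\<^sub>v ?u"
    using False by (auto intro!: eq_vecI)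
  ultimately show ?thesis
    by (intro bexI[of _ ?u]) auto
qed

text \<open>Cauchy-Schwarz, reduced by the triangle inequality to the real case for the moduli of
  the entries.\<close>

lemma cmod_cscalar_prod_le:
  assumes "dim_vec v = dim_vec w"
  shows "cmod (v \<bullet>c w) \<le> euclidean_norm v * euclidean_norm w"
proof -
  have "cmod (v \<bullet>c w) \<le> (\<Sum>i<dim_vec w. \<bar>cmod (v $ i)\<bar> * \<bar>cmod (w $ i)\<bar>)"
    using assms
    by (auto simp: scalar_prod_def lessThan_atLeast0 norm_mult intro!: order.trans[OF norm_sum])
  also have "\<dots> \<le> euclidean_norm v * euclidean_norm w"
    unfolding euclidean_norm_def assms by (rule L2_set_mult_ineq)
  finally show ?thesis .
qed

text \<open>The entries of the Gram matrix are the inner products of the columns; commuting the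
  factors puts the conjugate on the second one, as in \<open>orthonormal_columns\<close>.\<close>

lemma mat_adjoint_mult_orthonormal_columns:
  assumes "orthonormal_columns A"
  shows "mat_adjoint A * A = 1\<^sub>m (dim_col A)"
proof (rule eq_matI)
  fix i j
  assume "i < dim_row (1\<^sub>m (dim_col A))" "j < dim_col (1\<^sub>m (dim_col A))"
  then show "(mat_adjoint A * A) $$ (i, j) = 1\<^sub>m (dim_col A) $$ (i, j)"
    using assms
    by (auto simp: mat_adjoint_def orthonormal_columns_def comm_scalar_prod[of "conjugate _" "dim_row A"])
qed (auto simp: mat_adjoint_def)

lemma cscalar_prod_mult_mat_vec:
  fixes A :: "complex mat"
  assumes "v \<in> carrier_vec (dim_col A)" and "w \<in> carrier_vec (dim_row A)"
  shows "(A *\<^sub>v v) \<bullet>c w = v \<bullet>c (mat_adjoint A *\<^sub>v w)"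
proof -
  have "(A *\<^sub>v v) \<bullet>c w = (\<Sum>i<dim_row A. \<Sum>k<dim_col A. A $$ (i, k) * v $ k * cnj (w $ i))"
    using assms
    by (auto simp: scalar_prod_def lessThan_atLeast0 sum_distrib_right intro!: sum.cong)
  also have "\<dots> = (\<Sum>k<dim_col A. \<Sum>i<dim_row A. A $$ (i, k) * v $ k * cnj (w $ i))"
    by (rule sum.swap)
  also have "\<dots> = v \<bullet>c (mat_adjoint A *\<^sub>v w)"
    using assms
    by (auto simp: scalar_prod_def lessThan_atLeast0 sum_distrib_left mat_adjoint_def mult_ac
        intro!: sum.cong)
  finally show ?thesis .
qed

text \<open>Moving \<open>A\<close> to the other side of the inner product produces
  \<open>mat_adjoint A * A\<close>, which is the identity.\<close>

lemma euclidean_norm_mult_orthonormal_columns: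
  assumes "orthonormal_columns A" and "v \<in> carrier_vec (dim_col A)"
  shows "euclidean_norm (A *\<^sub>v v) = euclidean_norm v"
proof (rule euclidean_norm_eqI)
  have "(A *\<^sub>v v) \<bullet>c (A *\<^sub>v v) = v \<bullet>c (mat_adjoint A *\<^sub>v (A *\<^sub>v v))"
    by (rule cscalar_prod_mult_mat_vec) (use assms in \<open>auto intro: carrier_vecI\<close>)
  also have "mat_adjoint A *\<^sub>v (A *\<^sub>v v) = (mat_adjoint A * A) *\<^sub>v v"
    by (rule assoc_mult_mat_vec[symmetric]) (use assms in \<open>auto simp: mat_adjoint_def\<close>)
  also have "\<dots> = v"
    using assms by (simp add: mat_adjoint_mult_orthonormal_columns)
  finally show "(A *\<^sub>v v) \<bullet>c (A *\<^sub>v v) = v \<bullet>c v" .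
qed

text \<open>Only an inequality can hold: if \<open>A\<close> has more rows than columns, its adjoint
  has a nontrivial kernel. With \<open>w\<close> the image of \<open>v\<close> under the adjoint,
  the squared norm of \<open>w\<close> is the inner product of \<open>A *\<^sub>v w\<close> and
  \<open>v\<close>; Cauchy-Schwarz and the isometry \<open>A\<close> bound it by the product of the
  norms of \<open>w\<close> and \<open>v\<close>.\<close>

lemma euclidean_norm_mult_mat_adjoint_le:
  assumes "orthonormal_columns A" and v: "v \<in> carrier_vec (dim_row A)"
  shows "euclidean_norm (mat_adjoint A *\<^sub>v v) \<le> euclidean_norm v"
proof -
  let ?w = "mat_adjoint A *\<^sub>v v"
  have w: "?w \<in> carrier_vec (dim_col A)"
    by (auto simp: mat_adjoint_def intro: carrier_vecI)
  have "(euclidean_norm ?w)\<^sup>2 = cmod (?w \<bullet>c ?w)"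
    by (simp add: cscalar_prod_self norm_power)
  also have "\<dots> = cmod ((A *\<^sub>v ?w) \<bullet>c v)"
    using cscalar_prod_mult_mat_vec[OF w v] by simp
  also have "\<dots> \<le> euclidean_norm (A *\<^sub>v ?w) * euclidean_norm v"
    using v by (intro cmod_cscalar_prod_le) auto
  also have "\<dots> = euclidean_norm ?w * euclidean_norm v"
    by (simp add: euclidean_norm_mult_orthonormal_columns[OF assms(1) w])
  \<comment> \<open>One factor \<open>euclidean_norm ?w\<close> is cancelled; if it is 0, the claim
    is immediate.\<close>
  finally show ?thesis
    by (cases "euclidean_norm ?w = 0") (auto simp: power2_eq_square less_le)
qed


section \<open>Mode products of rank-one decompositions\<close>

lemma tensor_indices_update_iff:
  assumes "n < length ds"
  shows "is \<in> tensor_indices (ds[n := d]) \<longleftrightarrow>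
           length is = length ds \<and> is ! n < d \<and> (\<forall>m<length ds. m \<noteq> n \<longrightarrow> is ! m < ds ! m)"
  using assms by (auto simp: tensor_indices_def nth_list_update)

lemma tensor_indices_updateI:
  assumes "n < length ds" and "is \<in> tensor_indices (ds[n := d])" and "k < ds ! n"
  shows "is[n := k] \<in> tensor_indices ds"
  using assms by (auto simp: tensor_indices_def nth_list_update split: if_splits)

lemma dims_mode_product [simp]: "dims (mode_product X n A) = (dims X)[n := dim_row A]"
  by (simp add: mode_product_def)

lemma entry_mode_product:
  assumes "is \<in> tensor_indices ((dims X)[n := dim_row A])"
  shows "entry (mode_product X n A) is =
           (\<Sum>k<dims X ! n. entry X (is[n := k]) * A $$ (is ! n, k))"
  using assms by (simp add: mode_product_def)

text \<open>Interchanging the two finite sums contracts the intermediate index exactly as in the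
  matrix product.\<close>

lemma mode_product_mult:
  assumes n: "n < length (dims X)" and A: "dim_col A = dims X ! n" and B: "dim_col B = dim_row A"
  shows "mode_product (mode_product X n A) n B = mode_product X n (B * A)"
proof (rule tensor_eqI)
  show "dims (mode_product (mode_product X n A) n B) = dims (mode_product X n (B * A))"
    by simp
next
  fix "is"
  assume "is \<in> tensor_indices (dims (mode_product (mode_product X n A) n B))"
  then have is1: "is \<in> tensor_indices ((dims X)[n := dim_row B])"
    by simp
  then have len: "length is = length (dims X)" and isn: "is ! n < dim_row B"
    using n by (auto simp: tensor_indices_update_iff)
  \<comment> \<open>These are indices of the intermediate tensor, whose mode \<open>n\<close> has
    dimension \<open>dim_row A\<close>. Updating position \<open>n\<close> once more overwrites
    \<open>k\<close>.\<close>
  have upd: "is[n := k] \<in> tensor_indices ((dims X)[n := dim_row A])" if "k < dim_row A" for k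
    using that is1 n by (auto simp: tensor_indices_update_iff)
  have "entry (mode_product (mode_product X n A) n B) is =
      (\<Sum>k<dim_row A. (\<Sum>l<dims X ! n. entry X (is[n := l]) * A $$ (k, l)) * B $$ (is ! n, k))"
    using is1 n len by (simp add: entry_mode_product upd)
  also have "\<dots> = (\<Sum>l<dims X ! n. \<Sum>k<dim_row A. entry X (is[n := l]) * A $$ (k, l) * B $$ (is ! n, k))"
    unfolding sum_distrib_right by (rule sum.swap)
  also have "\<dots> = (\<Sum>l<dims X ! n. entry X (is[n := l]) * (B * A) $$ (is ! n, l))"
    using isn A B
    by (auto simp: scalar_prod_def lessThan_atLeast0 sum_distrib_left mult_ac intro!: sum.cong)
  also have "\<dots> = entry (mode_product X n (B * A)) is"
    using is1 by (simp add: entry_mode_product)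
  finally show "entry (mode_product (mode_product X n A) n B) is = entry (mode_product X n (B * A)) is" .
qed

lemma mode_product_one:
  assumes "n < length (dims X)"
  shows "mode_product X n (1\<^sub>m (dims X ! n)) = X"
proof (rule tensor_eqI)
  fix "is"
  assume is1: "is \<in> tensor_indices (dims (mode_product X n (1\<^sub>m (dims X ! n))))"
  then have "is ! n < dims X ! n"
    using assms by (simp add: tensor_indices_def)
  then have "(\<Sum>k<dims X ! n. entry X (is[n := k]) * 1\<^sub>m (dims X ! n) $$ (is ! n, k)) =
      (\<Sum>k<dims X ! n. if k = is ! n then entry X is else 0)"
    by (intro sum.cong) auto
  then show "entry (mode_product X n (1\<^sub>m (dims X ! n))) is = entry X is"
    using is1 \<open>is ! n < dims X ! n\<close> by (simp add: entry_mode_product)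
qed simp

text \<open>The adjoint is a left inverse of \<open>A\<close>, and a left inverse is what composing
  in this order requires.\<close>

lemma mode_product_adjoint_cancel:
  assumes "n < length (dims X)" and "dim_col A = dims X ! n" and "orthonormal_columns A"
  shows "mode_product (mode_product X n A) n (mat_adjoint A) = X"
proof -
  have "mode_product (mode_product X n A) n (mat_adjoint A) = mode_product X n (mat_adjoint A * A)"
    using assms by (intro mode_product_mult) (auto simp: mat_adjoint_def)
  then show ?thesis
    using assms by (metis mat_adjoint_mult_orthonormal_columns mode_product_one)
qed

text \<open>The mode product is linear in the tensor and acts on an outer product by applying
  \<open>B\<close> to its mode-\<open>n\<close> vector. The image of a unit vector has norm at most
  1; this norm goes into the scalar and a unit direction takes the vector's place.\<close>

lemma unit_rank_one_decomposition_mode_product: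
  assumes p: "0 < p" and n: "n < length (dims X)" and B: "dim_col B = dims X ! n"
    and contr: "\<And>v. v \<in> carrier_vec (dim_col B) \<Longrightarrow> euclidean_norm (B *\<^sub>v v) \<le> euclidean_norm v"
    and dec: "unit_rank_one_decomposition X r c x"
  shows "\<exists>r' c' x'. unit_rank_one_decomposition (mode_product X n B) r' c' x' \<and>
           (\<Sum>s<r'. cmod (c' s) powr p) \<le> (\<Sum>s<r. cmod (c s) powr p)"
proof (cases "dim_row B = 0")
  \<comment> \<open>Without rows in \<open>B\<close> there are no unit vectors for mode
    \<open>n\<close>, but the product has no entries either, so the empty decomposition
    works.\<close>
  case True
  then have "unit_rank_one_decomposition (mode_product X n B) 0 c x"
    using n by (auto simp: unit_rank_one_decomposition_def tensor_indices_update_iff intro!: tensor_eqI)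
  then show ?thesis
    by (intro exI[of _ 0] exI[of _ c] exI[of _ x]) (auto intro: sum_nonneg)
next
  case False
  define w where "w s = B *\<^sub>v (x s ! n)" for s
  have "\<exists>u. u \<in> carrier_vec (dim_row B) \<and> euclidean_norm u = 1 \<and>
      w s = complex_of_real (euclidean_norm (w s)) \<cdot>\<^sub>v u" for s
    using ex_unit_direction[of "w s"] False by (auto simp: w_def)
  then obtain u where u: "\<And>s. u s \<in> carrier_vec (dim_row B)" "\<And>s. euclidean_norm (u s) = 1"
      "\<And>s. w s = complex_of_real (euclidean_norm (w s)) \<cdot>\<^sub>v u s"
    by metis
  define c' where "c' s = c s * complex_of_real (euclidean_norm (w s))" for s
  define x' where "x' s = (x s)[n := u s]" for s
  have x: "length (x s) = length (dims X)"
      "\<And>m. m < length (dims X) \<Longrightarrow> x s ! m \<in> carrier_vec (dims X ! m)"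
      "\<And>m. m < length (dims X) \<Longrightarrow> euclidean_norm (x s ! m) = 1" if "s < r" for s
    using dec that by (auto simp: unit_rank_one_decomposition_def)
  have X: "X = tensor (dims X) (\<lambda>is. \<Sum>s<r. c s * entry (outer_product (x s)) is)"
    using dec by (simp add: unit_rank_one_decomposition_def)
  have dx: "map dim_vec (x s) = dims X" if "s < r" for s
    using x[OF that] by (auto intro!: nth_equalityI)
  have dx': "map dim_vec (x' s) = (dims X)[n := dim_row B]" if "s < r" for s
    using dx[OF that] u(1)[of s] by (simp add: x'_def map_update)
  have "mode_product X n B =
      tensor ((dims X)[n := dim_row B]) (\<lambda>is. \<Sum>s<r. c' s * entry (outer_product (x' s)) is)"
  proof (rule tensor_eqI)
    fix "is"
    assume "is \<in> tensor_indices (dims (mode_product X n B))"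
    then have is1: "is \<in> tensor_indices ((dims X)[n := dim_row B])"
      by simp
    then have len: "length is = length (dims X)" and isn: "is ! n < dim_row B"
      using n by (auto simp: tensor_indices_update_iff)
    have upd: "is[n := k] \<in> tensor_indices (dims X)" if "k < dims X ! n" for k
      using tensor_indices_updateI[OF n is1 that] .
    have "entry X (is[n := k]) = (\<Sum>s<r. c s * entry (outer_product (x s)) (is[n := k]))"
      if "k < dims X ! n" for k
      by (subst X) (simp add: upd[OF that])
    then have "entry (mode_product X n B) is =
        (\<Sum>k<dims X ! n. (\<Sum>s<r. c s * entry (outer_product (x s)) (is[n := k])) * B $$ (is ! n, k))"
      using is1 by (simp add: entry_mode_product)
    also have "\<dots> = (\<Sum>s<r. \<Sum>k<dims X ! n.
        c s * entry (outer_product (x s)) (is[n := k]) * B $$ (is ! n, k))"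
      unfolding sum_distrib_right by (rule sum.swap)
    also have "\<dots> = (\<Sum>s<r. c' s * entry (outer_product (x' s)) is)"
    proof (rule sum.cong)
      fix s
      assume "s \<in> {..<r}"
      then have s: "s < r"
        by simp
      \<comment> \<open>The contribution of the modes other than \<open>n\<close>: it is independent
        of the summation index \<open>k\<close> and the same for \<open>x s\<close> and
        \<open>x' s\<close>.\<close>
      define P where "P = (\<Prod>m\<in>{..<length (dims X)} - {n}. x s ! m $ (is ! m))"
      have "entry (outer_product (x s)) (is[n := k]) = x s ! n $ k * P" if "k < dims X ! n" for k
      proof -
        have "entry (outer_product (x s)) (is[n := k]) =
            (\<Prod>m<length (dims X). x s ! m $ (is[n := k] ! m))"
          using upd[OF that] dx[OF s] x(1)[OF s] by (simp add: outer_product_def)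
        also have "\<dots> = x s ! n $ k * P"
          using n len by (subst prod.remove[of _ n]) (auto simp: P_def intro!: prod.cong)
        finally show ?thesis .
      qed
      then have "(\<Sum>k<dims X ! n. c s * entry (outer_product (x s)) (is[n := k]) * B $$ (is ! n, k)) =
          c s * P * (\<Sum>k<dims X ! n. B $$ (is ! n, k) * x s ! n $ k)"
        by (simp add: sum_distrib_left mult_ac)
      also have "(\<Sum>k<dims X ! n. B $$ (is ! n, k) * x s ! n $ k) = w s $ (is ! n)"
        using isn B x(2)[OF s n] by (simp add: w_def scalar_prod_def lessThan_atLeast0)
      also have "\<dots> = complex_of_real (euclidean_norm (w s)) * u s $ (is ! n)"
        using isn u(1)[of s] by (subst u(3)) simp
      also have "c s * P * \<dots> = c' s * (u s $ (is ! n) * P)"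
        by (simp add: c'_def)
      also have "u s $ (is ! n) * P = (\<Prod>m<length (dims X). x' s ! m $ (is ! m))"
        using n x(1)[OF s] by (subst prod.remove[of _ n]) (auto simp: P_def x'_def intro!: prod.cong)
      also have "\<dots> = entry (outer_product (x' s)) is"
        using is1 dx'[OF s] x(1)[OF s] by (simp add: outer_product_def x'_def)
      finally show "(\<Sum>k<dims X ! n. c s * entry (outer_product (x s)) (is[n := k]) * B $$ (is ! n, k)) =
          c' s * entry (outer_product (x' s)) is" .
    qed simp
    finally show "entry (mode_product X n B) is =
        entry (tensor ((dims X)[n := dim_row B])
          (\<lambda>is. \<Sum>s<r. c' s * entry (outer_product (x' s)) is)) is"
      using is1 by simp
  qed simp
  then have "unit_rank_one_decomposition (mode_product X n B) r c' x'"
    using x u n by (auto simp: unit_rank_one_decomposition_def x'_def nth_list_update)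
  moreover have "(\<Sum>s<r. cmod (c' s) powr p) \<le> (\<Sum>s<r. cmod (c s) powr p)"
  proof (rule sum_mono)
    fix s
    assume "s \<in> {..<r}"
    then have "euclidean_norm (w s) \<le> 1"
      using contr[of "x s ! n"] x(2,3)[of s n] n B by (simp add: w_def)
    then have "cmod (c' s) \<le> cmod (c s)"
      by (simp add: c'_def norm_mult mult_left_le)
    then show "cmod (c' s) powr p \<le> cmod (c s) powr p"
      using p by (simp add: powr_mono2)
  qed
  ultimately show ?thesis
    by blast
qed


section \<open>Invariance of the quasi-norm\<close>

text \<open>Domination carries emptiness from either set to the other, so no decomposition has to be
  exhibited to compare the infima; for nonempty sets each infimum bounds the other.\<close>

lemma Inf_eq_if_mutually_dominating:
  fixes S T :: "real set"
  assumes "bdd_below S" and "bdd_below T"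
    and "\<And>s. s \<in> S \<Longrightarrow> \<exists>t\<in>T. t \<le> s" and "\<And>t. t \<in> T \<Longrightarrow> \<exists>s\<in>S. s \<le> t"
  shows "Inf S = Inf T"
proof (cases "S = {}")
  case True
  then have "T = {}"
    using assms(4) by auto
  then show ?thesis
    using True by simp
next
  case False
  then have "T \<noteq> {}"
    using assms(3) by auto
  then show ?thesis
    using False assms by (intro antisym cInf_mono) auto
qed

text \<open>It suffices to compare the sums of \<open>p\<close>-th powers, because the outer power
  \<open>1 / p\<close> is monotone on nonnegative reals.\<close>

lemma tensor_pnorm_eqI:
  assumes "0 < p"
    and "\<And>r c x. unit_rank_one_decomposition X r c x \<Longrightarrow>
           \<exists>r' c' x'. unit_rank_one_decomposition Y r' c' x' \<and>
             (\<Sum>s<r'. cmod (c' s) powr p) \<le> (\<Sum>s<r. cmod (c s) powr p)"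
    and "\<And>r c x. unit_rank_one_decomposition Y r c x \<Longrightarrow>
           \<exists>r' c' x'. unit_rank_one_decomposition X r' c' x' \<and>
             (\<Sum>s<r'. cmod (c' s) powr p) \<le> (\<Sum>s<r. cmod (c s) powr p)"
  shows "tensor_pnorm p X = tensor_pnorm p Y"
proof -
  let ?S = "\<lambda>Z. {(\<Sum>s<r. cmod (c s) powr p) powr (1 / p) | r c x. unit_rank_one_decomposition Z r c x}"
  have bdd: "bdd_below (?S Z)" for Z
    by (rule bdd_belowI[of _ 0]) auto
  \<comment> \<open>Stated for arbitrary tensors so that it serves both directions.\<close>
  have dom: "\<exists>t\<in>?S Z'. t \<le> a"
    if mem: "a \<in> ?S Z"
      and *: "\<And>r c x. unit_rank_one_decomposition Z r c x \<Longrightarrow>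
           \<exists>r' c' x'. unit_rank_one_decomposition Z' r' c' x' \<and>
             (\<Sum>s<r'. cmod (c' s) powr p) \<le> (\<Sum>s<r. cmod (c s) powr p)" for Z Z' a
  proof -
    obtain r c x where "unit_rank_one_decomposition Z r c x"
      and a: "a = (\<Sum>s<r. cmod (c s) powr p) powr (1 / p)"
      using mem by blast
    then obtain r' c' x' where dec: "unit_rank_one_decomposition Z' r' c' x'"
      and le: "(\<Sum>s<r'. cmod (c' s) powr p) \<le> (\<Sum>s<r. cmod (c s) powr p)"
      using * by blast
    have "(\<Sum>s<r'. cmod (c' s) powr p) powr (1 / p) \<le> a"
      unfolding a using le \<open>0 < p\<close> by (intro powr_mono2 sum_nonneg) auto
    then show ?thesis
      using dec by blast
  qed
  show ?thesis
    unfolding tensor_pnorm_def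
    by (rule Inf_eq_if_mutually_dominating[OF bdd bdd])
      (erule dom, erule assms(2,3))+
qed

text \<open>Decompositions are transported forward by the isometry \<open>A\<close> and back by its
  adjoint, a contraction that recovers \<open>X\<close>.\<close>

lemma tensor_pnorm_mode_product:
  assumes "0 < p" and n: "n < length (dims X)" and A: "dim_col A = dims X ! n"
    and orth: "orthonormal_columns A"
  shows "tensor_pnorm p (mode_product X n A) = tensor_pnorm p X"
proof (rule tensor_pnorm_eqI[OF \<open>0 < p\<close>])
  fix r c x
  assume "unit_rank_one_decomposition X r c x"
  with assms show "\<exists>r' c' x'. unit_rank_one_decomposition (mode_product X n A) r' c' x' \<and>
      (\<Sum>s<r'. cmod (c' s) powr p) \<le> (\<Sum>s<r. cmod (c s) powr p)"
    by (intro unit_rank_one_decomposition_mode_product)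
      (auto simp: euclidean_norm_mult_orthonormal_columns)
next
  fix r c x
  assume "unit_rank_one_decomposition (mode_product X n A) r c x"
  then have "\<exists>r' c' x'.
      unit_rank_one_decomposition (mode_product (mode_product X n A) n (mat_adjoint A)) r' c' x' \<and>
      (\<Sum>s<r'. cmod (c' s) powr p) \<le> (\<Sum>s<r. cmod (c s) powr p)"
    using assms
    by (intro unit_rank_one_decomposition_mode_product)
      (auto simp: mat_adjoint_def intro: euclidean_norm_mult_mat_adjoint_le[unfolded mat_adjoint_def])
  then show "\<exists>r' c' x'. unit_rank_one_decomposition X r' c' x' \<and>
      (\<Sum>s<r'. cmod (c' s) powr p) \<le> (\<Sum>s<r. cmod (c s) powr p)"
    by (simp add: mode_product_adjoint_cancel[OF n A orth])
qed

lemma tensor_pnorm_tucker: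
  assumes "0 < p" and "length U = length (dims G)"
    and "\<And>n. n < length U \<Longrightarrow> dim_col (U ! n) = dims G ! n"
    and "\<And>n. n < length U \<Longrightarrow> orthonormal_columns (U ! n)"
  shows "tensor_pnorm p (tucker G U) = tensor_pnorm p G"
proof -
  \<comment> \<open>The core after its first \<open>k\<close> modes have been multiplied. The
    invariant below records that the order is unchanged and that modes from \<open>k\<close> on keep
    the dimensions of \<open>G\<close>, so the next factor still fits.\<close>
  define T where "T k = fold (\<lambda>n X. mode_product X n (U ! n)) [0..<k] G" for k
  have "tensor_pnorm p (T k) = tensor_pnorm p G \<and> length (dims (T k)) = length (dims G) \<and>
      (\<forall>n \<ge> k. dims (T k) ! n = dims G ! n)" if "k \<le> length U" for k
    using that
  proof (induction k)
    case 0
    then show ?case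
      by (simp add: T_def)
  next
    case (Suc k)
    moreover have "T (Suc k) = mode_product (T k) k (U ! k)"
      by (simp add: T_def)
    ultimately show ?case
      using assms by (simp add: tensor_pnorm_mode_product)
  qed
  then show ?thesis
    by (simp add: tucker_def T_def)
qed

theorem corollary10:
  fixes p :: real
    and I J :: "nat list"
    and X G :: "complex tensor"
    and U :: "complex mat list"
  assumes "0 < p" and "p \<le> 1"
    and "length J = length I" and "length U = length I"
    and "X \<in> carrier_tensor I" and "G \<in> carrier_tensor J"
    and "\<And>n. n < length I \<Longrightarrow> U ! n \<in> carrier_mat (I ! n) (J ! n)"
    and "\<And>n. n < length I \<Longrightarrow> orthonormal_columns (U ! n)"
    and "X = tucker G U"
  shows "tensor_pnorm p X = tensor_pnorm p G"
proof -
  have "dim_col (U ! n) = dims G ! n" if "n < length U" for n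
    using assms(4,6) assms(7)[of n] that by (auto simp: carrier_tensor_def)
  then show ?thesis
    using assms by (auto simp: carrier_tensor_def intro!: tensor_pnorm_tucker)
qed

end
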